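(* Let $\mathscr{H}_2$ be a separable real Hilbert space and let $K:\ell^2\to\mathscr{H}_2$ be a bounded linear operator. Let $I\subset\mathbb{Z}$ be finite and let $K$ restricted to $\operatorname{span}\{e_i: i\in I\}$ be injective. Assume $$\sup_{i\in I^{\complement}}\|(KP_I)^{\dagger}Ke_i\|_{\ell^1}<1 .$$ Then for every $u^{\diamond}\in\ell^2$ with $\operatorname{supp}(u^{\diamond})\subset I$ there exists $w\in\mathscr{H}_2$ such that $$P_IK^*w=P_I\operatorname{sign}(u^{\diamond})\qquad\text{and}\qquad\|P_{I^{\complement}}K^*w\|_{\ell^\infty}<1 .$$
   Context: $\ell^2=\ell^2(\mathbb{Z},\mathbb{R})$ with standard basis $\{e_j\}_{j\in\mathbb{Z}}$; $\operatorname{supp}(u)=\{i\in\mathbb{Z}: u_i\neq 0\}$; $I^{\complement}=\mathbb{Z}\setminus I$. For $J\subset\mathbb{Z}$, $P_J:\ell^2\to\ell^2$ is the projection $P_Ju=\sum_{j\in J}u_je_j$. $B^{\dagger}$ denotes the Moore–Penrose pseudoinverse of a linear operator $B$. $\operatorname{sign}(u)$ is the componentwise sign of $u$, with $\operatorname{sign}(0)=0$. *)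

theory Defs
  imports "HOL-Analysis.Analysis"
begin

section \<open>The space of square-summable real sequences indexed by the integers\<close>

typedef l2 = "{f :: int \<Rightarrow> real. (\<lambda>i. (f i)\<^sup>2) summable_on UNIV}"
  morphisms coord Abs_l2
  by (rule exI[of _ "\<lambda>_. 0"]) simp

setup_lifting type_definition_l2

lemma l2_eqI: "(\<And>i. coord x i = coord y i) \<Longrightarrow> x = y"
  by (simp add: coord_inject[symmetric] fun_eq_iff)

lemma sq_summable_mult:
  fixes f g :: "int \<Rightarrow> real"
  assumes "(\<lambda>i. (f i)\<^sup>2) summable_on UNIV" "(\<lambda>i. (g i)\<^sup>2) summable_on UNIV"
  shows "(\<lambda>i. f i * g i) summable_on UNIV"
proof -
  have s: "(\<lambda>i. (f i)\<^sup>2 + (g i)\<^sup>2) summable_on UNIV"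
    using assms by (rule summable_on_add)
  have "(\<lambda>i. norm (f i * g i)) summable_on UNIV"
  proof (rule summable_on_comparison_test[OF s])
    fix i
    have "2 * (\<bar>f i\<bar> * \<bar>g i\<bar>) \<le> (f i)\<^sup>2 + (g i)\<^sup>2"
      using sum_squares_bound[of "\<bar>f i\<bar>" "\<bar>g i\<bar>"] by simp
    moreover have "0 \<le> \<bar>f i\<bar> * \<bar>g i\<bar>" by simp
    ultimately have "\<bar>f i\<bar> * \<bar>g i\<bar> \<le> (f i)\<^sup>2 + (g i)\<^sup>2" by linarith
    then show "norm (f i * g i) \<le> (f i)\<^sup>2 + (g i)\<^sup>2"
      by (simp add: abs_mult)
  qed auto
  then show ?thesis by (rule abs_summable_summable)
qed

lemma sq_summable_add:
  fixes f g :: "int \<Rightarrow> real"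
  assumes "(\<lambda>i. (f i)\<^sup>2) summable_on UNIV" "(\<lambda>i. (g i)\<^sup>2) summable_on UNIV"
  shows "(\<lambda>i. (f i + g i)\<^sup>2) summable_on UNIV"
proof -
  have "(\<lambda>i. (f i)\<^sup>2 + (g i)\<^sup>2 + 2 * (f i * g i)) summable_on UNIV"
    by (intro summable_on_add assms summable_on_cmult_right sq_summable_mult)
  then show ?thesis by (simp add: power2_sum mult.assoc)
qed

lemma sq_summable_scale:
  fixes f :: "int \<Rightarrow> real"
  assumes "(\<lambda>i. (f i)\<^sup>2) summable_on UNIV"
  shows "(\<lambda>i. (c * f i)\<^sup>2) summable_on UNIV"
  using summable_on_cmult_right[OF assms, of "c\<^sup>2"] by (simp add: power_mult_distrib)

lemma sq_summable_finite:
  fixes f :: "int \<Rightarrow> real"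
  assumes "finite {i. f i \<noteq> 0}"
  shows "(\<lambda>i. (f i)\<^sup>2) summable_on UNIV"
proof -
  have "(\<lambda>i. (f i)\<^sup>2) summable_on {i. f i \<noteq> 0}"
    using assms by (rule summable_on_finite)
  then show ?thesis
    by (rule summable_on_cong_neutral[THEN iffD1, rotated -1]) auto
qed

instantiation l2 :: real_vector
begin

lift_definition zero_l2 :: l2 is "\<lambda>_. 0" by simp

lift_definition plus_l2 :: "l2 \<Rightarrow> l2 \<Rightarrow> l2" is "\<lambda>f g i. f i + g i"
  by (rule sq_summable_add)

lift_definition scaleR_l2 :: "real \<Rightarrow> l2 \<Rightarrow> l2" is "\<lambda>c f i. c * f i"
  by (rule sq_summable_scale)

lift_definition uminus_l2 :: "l2 \<Rightarrow> l2" is "\<lambda>f i. - f i" by simp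

lift_definition minus_l2 :: "l2 \<Rightarrow> l2 \<Rightarrow> l2" is "\<lambda>f g i. f i - g i"
  subgoal for f g using sq_summable_add[of f "\<lambda>i. - g i"] by simp
  done

instance
  by standard (transfer; simp add: fun_eq_iff algebra_simps)+

end

instantiation l2 :: real_inner
begin

lift_definition inner_l2 :: "l2 \<Rightarrow> l2 \<Rightarrow> real" is "\<lambda>f g. \<Sum>\<^sub>\<infinity>i. f i * g i" .

definition norm_l2 :: "l2 \<Rightarrow> real" where
  "norm_l2 x = sqrt (inner x x)"

definition sgn_l2 :: "l2 \<Rightarrow> l2" where
  "sgn_l2 x = x /\<^sub>R norm x"

definition dist_l2 :: "l2 \<Rightarrow> l2 \<Rightarrow> real" where
  "dist_l2 x y = norm (x - y)"

definition uniformity_l2 :: "(l2 \<times> l2) filter" where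
  "uniformity_l2 = (INF e\<in>{0<..}. principal {(x, y). dist x y < e})"

definition open_l2 :: "l2 set \<Rightarrow> bool" where
  "open_l2 U \<longleftrightarrow> (\<forall>x\<in>U. eventually (\<lambda>(x', y). x' = x \<longrightarrow> y \<in> U) uniformity)"

instance
proof
  fix x y z :: l2 and r :: real and U :: "l2 set"
  show "dist x y = norm (x - y)" by (rule dist_l2_def)
  show "sgn x = x /\<^sub>R norm x" by (rule sgn_l2_def)
  show "uniformity = (INF e\<in>{0<..}. principal {(x, y :: l2). dist x y < e})"
    by (rule uniformity_l2_def)
  show "open U \<longleftrightarrow> (\<forall>x\<in>U. eventually (\<lambda>(x', y). x' = x \<longrightarrow> y \<in> U) uniformity)"
    by (rule open_l2_def)
  show "inner x y = inner y x" by transfer (simp add: mult.commute)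
  show "inner (x + y) z = inner x z + inner y z"
    by transfer (simp add: distrib_right infsum_add sq_summable_mult)
  show "inner (scaleR r x) y = r * inner x y"
    by transfer (simp add: mult.assoc infsum_cmult_right' sq_summable_mult)
  show "0 \<le> inner x x"
    by transfer (auto intro!: infsum_nonneg)
  show "inner x x = 0 \<longleftrightarrow> x = 0"
  proof transfer
    fix f :: "int \<Rightarrow> real"
    assume s: "(\<lambda>i. (f i)\<^sup>2) summable_on UNIV"
    have *: "f i = 0" if "(\<Sum>\<^sub>\<infinity>i. f i * f i) = 0" for i
    proof -
      have "(\<lambda>i. f i * f i) summable_on UNIV"
        using s by (simp only: power2_eq_square)
      then have "f i * f i = 0"
        using that by (intro nonneg_infsum_le_0D[of "\<lambda>i. f i * f i" UNIV]) simp_all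
      then show ?thesis by simp
    qed
    show "(\<Sum>\<^sub>\<infinity>i. f i * f i) = 0 \<longleftrightarrow> f = (\<lambda>_. 0)"
    proof
      assume "(\<Sum>\<^sub>\<infinity>i. f i * f i) = 0"
      then show "f = (\<lambda>_. 0)" by (intro ext *)
    qed simp
  qed
  show "norm x = sqrt (inner x x)" by (rule norm_l2_def)
qed

end

lift_definition basis_vec :: "int \<Rightarrow> l2" is "\<lambda>j i. if i = j then 1 else 0"
  by (rule sq_summable_finite) simp

definition supp :: "l2 \<Rightarrow> int set" where
  "supp u = {i. coord u i \<noteq> 0}"

lift_definition proj :: "int set \<Rightarrow> l2 \<Rightarrow> l2" is "\<lambda>J f i. if i \<in> J then f i else 0"
  subgoal for J f
    by (rule summable_on_comparison_test[where f = "\<lambda>i. (f i)\<^sup>2"]) auto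
  done

text \<open>The componentwise sign, which must not be confused with the normalisation \<^term>\<open>sgn u\<close>
  of the class of normed spaces. It is an element of \<open>\<ell>\<^sup>2\<close> only if the support of \<open>u\<close> is
  finite; the value zero in the remaining case is a convention.\<close>

lift_definition sign_l2 :: "l2 \<Rightarrow> l2" is
  "\<lambda>f. if finite {i. f i \<noteq> 0} then (\<lambda>i. sgn (f i)) else (\<lambda>_. 0)"
  by (auto intro!: sq_summable_finite simp: sgn_eq_0_iff)

text \<open>These norms take values in the extended nonnegative reals, so that they, and suprema of
  them, are infinite when the sum or supremum diverges.\<close>

definition l1_norm :: "l2 \<Rightarrow> ennreal" where
  "l1_norm u = (\<Sum>\<^sub>\<infinity>i. ennreal \<bar>coord u i\<bar>)"

definition linf_norm :: "l2 \<Rightarrow> ennreal" where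
  "linf_norm u = (SUP i. ennreal \<bar>coord u i\<bar>)"

lemma coord_zero [simp]: "coord 0 i = 0" by transfer simp
lemma coord_add [simp]: "coord (x + y) i = coord x i + coord y i" by transfer simp
lemma coord_diff [simp]: "coord (x - y) i = coord x i - coord y i" by transfer simp
lemma coord_scaleR [simp]: "coord (c *\<^sub>R x) i = c * coord x i" by transfer simp
lemma coord_proj: "coord (proj J u) i = (if i \<in> J then coord u i else 0)" by transfer simp
lemma coord_basis_vec: "coord (basis_vec j) i = (if i = j then 1 else 0)" by transfer simp
lemma coord_sum: "coord (sum f A) i = (\<Sum>a\<in>A. coord (f a) i)"
  by (induction A rule: infinite_finite_induct) auto
lemma coord_sign: "finite (supp u) \<Longrightarrow> coord (sign_l2 u) i = sgn (coord u i)"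
  unfolding supp_def by transfer simp

lemma coord_sq_summable: "(\<lambda>i. (coord u i)\<^sup>2) summable_on UNIV"
  using coord[of u] by simp

lemma norm_l2_sq: "(norm u)\<^sup>2 = (\<Sum>\<^sub>\<infinity>i. (coord u i)\<^sup>2)"
  unfolding power2_norm_eq_inner by transfer (simp add: power2_eq_square)

lemma proj_finite: "finite J \<Longrightarrow> proj J u = (\<Sum>j\<in>J. coord u j *\<^sub>R basis_vec j)"
  by (rule l2_eqI) (auto simp: coord_proj coord_sum coord_basis_vec if_distrib cong: if_cong)

lemma proj_has_sum: "((\<lambda>j. coord u j *\<^sub>R basis_vec j) has_sum proj J u) J"
proof -
  have sJ: "(\<lambda>i. (coord u i)\<^sup>2) summable_on J"
    using coord_sq_summable by (rule summable_on_subset_banach) simp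
  have eq: "(dist (\<Sum>j\<in>F. coord u j *\<^sub>R basis_vec j) (proj J u))\<^sup>2
      = (\<Sum>\<^sub>\<infinity>i\<in>J. (coord u i)\<^sup>2) - (\<Sum>i\<in>F. (coord u i)\<^sup>2)" if "finite F" "F \<subseteq> J" for F
  proof -
    have "(dist (\<Sum>j\<in>F. coord u j *\<^sub>R basis_vec j) (proj J u))\<^sup>2
        = (\<Sum>\<^sub>\<infinity>i. (coord (proj F u - proj J u) i)\<^sup>2)"
      using that by (simp only: dist_norm norm_l2_sq proj_finite)
    also have "\<dots> = (\<Sum>\<^sub>\<infinity>i\<in>J - F. (coord u i)\<^sup>2)"
      using that by (intro infsum_cong_neutral) (auto simp: coord_proj)
    also have "\<dots> = (\<Sum>\<^sub>\<infinity>i\<in>J. (coord u i)\<^sup>2) - (\<Sum>\<^sub>\<infinity>i\<in>F. (coord u i)\<^sup>2)"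
      using that sJ by (intro infsum_Diff) auto
    finally show ?thesis using that by simp
  qed
  have "((\<lambda>F. \<Sum>i\<in>F. (coord u i)\<^sup>2) \<longlongrightarrow> (\<Sum>\<^sub>\<infinity>i\<in>J. (coord u i)\<^sup>2)) (finite_subsets_at_top J)"
    using sJ by (simp add: has_sum_def[symmetric])
  then have "((\<lambda>F. sqrt ((\<Sum>\<^sub>\<infinity>i\<in>J. (coord u i)\<^sup>2) - (\<Sum>i\<in>F. (coord u i)\<^sup>2))) \<longlongrightarrow> sqrt (
      (\<Sum>\<^sub>\<infinity>i\<in>J. (coord u i)\<^sup>2) - (\<Sum>\<^sub>\<infinity>i\<in>J. (coord u i)\<^sup>2))) (finite_subsets_at_top J)"
    by (intro tendsto_intros)
  then have "((\<lambda>F. sqrt ((\<Sum>\<^sub>\<infinity>i\<in>J. (coord u i)\<^sup>2) - (\<Sum>i\<in>F. (coord u i)\<^sup>2))) \<longlongrightarrow> 0)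
      (finite_subsets_at_top J)"
    by simp
  moreover have "\<forall>\<^sub>F F in finite_subsets_at_top J.
      sqrt ((\<Sum>\<^sub>\<infinity>i\<in>J. (coord u i)\<^sup>2) - (\<Sum>i\<in>F. (coord u i)\<^sup>2))
      = dist (\<Sum>j\<in>F. coord u j *\<^sub>R basis_vec j) (proj J u)"
    by (rule eventually_finite_subsets_at_top_weakI) (simp flip: eq)
  ultimately show ?thesis
    unfolding has_sum_def tendsto_dist_iff[of _ "proj J u"]
    by (rule Lim_transform_eventually)
qed

section \<open>Adjoint and Moore--Penrose pseudoinverse\<close>

text \<open>The library constant \<^const>\<open>adjoint\<close> is defined by choice; for bounded operators on
  \<open>\<ell>\<^sup>2\<close> the choice is from a nonempty set (and unique by the lemma \<open>adjoint_unique\<close>).\<close>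

lemma inner_basis_vec: "inner (basis_vec j) u = coord u j"
proof -
  have "inner (basis_vec j) u = (\<Sum>\<^sub>\<infinity>i. coord (basis_vec j) i * coord u i)"
    by transfer simp
  also have "\<dots> = (\<Sum>\<^sub>\<infinity>i\<in>{j}. coord u i)"
    by (rule infsum_cong_neutral) (auto simp: coord_basis_vec)
  finally show ?thesis by simp
qed

lemma adjoint_l2_works:
  fixes K :: "l2 \<Rightarrow> 'h::real_inner"
  assumes "bounded_linear K"
  shows "inner (K u) w = inner u (adjoint K w)"
proof -
  interpret K: bounded_linear K by fact
  have ex: "\<exists>v. \<forall>u. inner (K u) w = inner u v" for w
  proof -
    define f where "f i = inner (K (basis_vec i)) w" for i
    have bd: "(\<Sum>i\<in>F. (f i)\<^sup>2) \<le> (onorm K * norm w)\<^sup>2" if F: "finite F" for F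
    proof -
      define x where "x = (\<Sum>i\<in>F. f i *\<^sub>R basis_vec i)"
      define S where "S = (\<Sum>i\<in>F. (f i)\<^sup>2)"
      have cx: "coord x i = (if i \<in> F then f i else 0)" for i
        using F by (simp add: x_def coord_sum coord_basis_vec if_distrib cong: if_cong)
      have nx: "(norm x)\<^sup>2 = S"
      proof -
        have "(norm x)\<^sup>2 = (\<Sum>\<^sub>\<infinity>i\<in>F. (f i)\<^sup>2)"
          unfolding norm_l2_sq by (rule infsum_cong_neutral) (auto simp: cx)
        then show ?thesis using F by (simp add: S_def)
      qed
      have "S = inner (K x) w"
        by (simp add: S_def x_def K.sum K.scaleR inner_sum_left f_def power2_eq_square)
      also have "\<dots> \<le> norm (K x) * norm w" by (rule norm_cauchy_schwarz)
      also have "\<dots> \<le> onorm K * norm x * norm w"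
        by (intro mult_right_mono onorm assms) auto
      finally have le: "(norm x)\<^sup>2 \<le> (onorm K * norm w) * norm x"
        by (simp add: nx mult_ac)
      have "norm x \<le> onorm K * norm w"
      proof (cases "norm x = 0")
        case True
        then show ?thesis using onorm_pos_le[OF assms] by simp
      next
        case False
        then have "norm x > 0" by simp
        then show ?thesis using le by (simp add: power2_eq_square)
      qed
      then have "(norm x)\<^sup>2 \<le> (onorm K * norm w)\<^sup>2" by (simp add: power_mono)
      then show ?thesis by (simp add: nx S_def)
    qed
    have "(\<lambda>i. (f i)\<^sup>2) summable_on UNIV"
      by (rule nonneg_bdd_above_summable_on) (auto intro!: bdd_aboveI2 bd)
    then have cv: "coord (Abs_l2 f) = f" by (simp add: Abs_l2_inverse)
    have "inner (K u) w = inner u (Abs_l2 f)" for u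
    proof -
      have u: "((\<lambda>j. coord u j *\<^sub>R basis_vec j) has_sum u) UNIV"
        using proj_has_sum[of u UNIV] by (simp add: l2_eqI[of "proj UNIV u" u] coord_proj)
      have b1: "bounded_linear (\<lambda>u. inner (K u) w)"
        by (intro bounded_linear_inner_left_comp assms)
      have b2: "bounded_linear (\<lambda>u. inner u (Abs_l2 f))"
        by (rule bounded_linear_inner_left)
      have "((\<lambda>j. inner (K (coord u j *\<^sub>R basis_vec j)) w) has_sum inner (K u) w) UNIV"
        using has_sum_bounded_linear[OF b1 u] by (simp add: o_def)
      moreover have "((\<lambda>j. inner (coord u j *\<^sub>R basis_vec j) (Abs_l2 f))
          has_sum inner u (Abs_l2 f)) UNIV"
        using has_sum_bounded_linear[OF b2 u] by (simp add: o_def)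
      moreover have "inner (K (coord u j *\<^sub>R basis_vec j)) w
          = inner (coord u j *\<^sub>R basis_vec j) (Abs_l2 f)" for j
        by (simp add: K.scaleR inner_basis_vec cv f_def)
      ultimately show ?thesis by (simp add: has_sum_unique)
    qed
    then show ?thesis by blast
  qed
  then obtain g where "\<forall>w u. inner (K u) w = inner u (g w)" by metis
  then have g: "\<forall>x y. inner (K x) y = inner x (g y)" by blast
  then show ?thesis by (simp only: adjoint_unique[OF g])
qed

text \<open>The four Penrose equations, with self-adjointness of \<open>B X\<close> and \<open>X B\<close> written out. For a
  bounded operator \<open>B\<close> between Hilbert spaces a bounded solution \<open>X\<close> exists iff \<open>B\<close> has closed
  range, in particular if \<open>B\<close> has finite rank.\<close>

definition is_pseudoinverse :: "('a::real_inner \<Rightarrow> 'b::real_inner) \<Rightarrow> ('b \<Rightarrow> 'a) \<Rightarrow> bool" where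
  "is_pseudoinverse B X \<longleftrightarrow> bounded_linear X
     \<and> (\<forall>x. B (X (B x)) = B x)
     \<and> (\<forall>y. X (B (X y)) = X y)
     \<and> (\<forall>y z. inner (B (X y)) z = inner y (B (X z)))
     \<and> (\<forall>x z. inner (X (B x)) z = inner x (X (B z)))"

definition pseudoinverse :: "('a::real_inner \<Rightarrow> 'b::real_inner) \<Rightarrow> 'b \<Rightarrow> 'a" where
  "pseudoinverse B = (THE X. is_pseudoinverse B X)"

lemma is_pseudoinverse_unique:
  assumes X: "is_pseudoinverse B X" and Y: "is_pseudoinverse B Y"
  shows "X = Y"
proof
  fix y
  have x: "B (X (B a)) = B a" "X (B (X b)) = X b"
      "inner (B (X b)) c = inner b (B (X c))" "inner (X (B a)) d = inner a (X (B d))" for a b c d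
    using X by (auto simp: is_pseudoinverse_def)
  have y: "B (Y (B a)) = B a" "Y (B (Y b)) = Y b"
      "inner (B (Y b)) c = inner b (B (Y c))" "inner (Y (B a)) d = inner a (Y (B d))" for a b c d
    using Y by (auto simp: is_pseudoinverse_def)
  have BX: "B (X b) = B (Y b)" for b
  proof (rule vector_eq_rdot[THEN iffD1, rule_format])
    fix c
    have "inner (B (X b)) c = inner (B (Y (B (X b)))) c" by (simp add: y)
    also have "\<dots> = inner b (B (X (B (Y c))))" by (simp only: x(3) y(3))
    also have "\<dots> = inner (B (Y b)) c" by (simp add: x(1) y(3))
    finally show "inner (B (X b)) c = inner (B (Y b)) c" .
  qed
  have XB: "X (B a) = Y (B a)" for a
  proof (rule vector_eq_rdot[THEN iffD1, rule_format])
    fix d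
    have "inner (X (B a)) d = inner (X (B (Y (B a)))) d" by (simp add: y)
    also have "\<dots> = inner a (Y (B (X (B d))))" by (simp only: x(4) y(4))
    also have "\<dots> = inner (Y (B a)) d" by (simp add: x(1) y(4))
    finally show "inner (X (B a)) d = inner (Y (B a)) d" .
  qed
  have "X y = X (B (X y))" by (simp add: x)
  also have "\<dots> = Y (B (Y y))" by (simp add: XB BX)
  also have "\<dots> = Y y" by (simp add: y)
  finally show "X y = Y y" .
qed

lemma pseudoinverse_eqI: "is_pseudoinverse B X \<Longrightarrow> pseudoinverse B = X"
  unfolding pseudoinverse_def by (rule the_equality) (auto intro: is_pseudoinverse_unique)

end

theory Submission
  imports Defs
begin

text \<open>
  Write \<open>B\<close> for \<open>K\<close> composed with the projection onto the coordinates in \<open>I\<close>, and \<open>s\<close> for the sign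
  of \<open>u\<close>. The certificate is \<open>w = (B\<^sup>\<dagger>)\<^sup>* s\<close>. Its back-projection has the coordinates
  \<open>\<langle>e\<^sub>j, K\<^sup>* w\<rangle> = \<langle>s, B\<^sup>\<dagger> K e\<^sub>j\<rangle>\<close>. For \<open>j \<in> I\<close>, injectivity gives \<open>B\<^sup>\<dagger> K e\<^sub>j = e\<^sub>j\<close>, so the
  coordinate is \<open>s\<^sub>j\<close>. For \<open>j \<notin> I\<close>, since the entries of \<open>s\<close> lie in \<open>[-1, 1]\<close>, the coordinate has
  absolute value at most the \<open>\<ell>\<^sup>1\<close> norm of \<open>B\<^sup>\<dagger> K e\<^sub>j\<close>, and the hypothesis bounds the supremum of these norms.

  Since \<open>I\<close> is finite, all of this can be made explicit. The vectors \<open>K e\<^sub>i\<close> with \<open>i \<in> I\<close> are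
  linearly independent, so their span \<open>V\<close> contains a dual family \<open>d\<^sub>i\<close>, biorthogonal to them
  (lemma \<open>biorthogonal_family_exists\<close>). Then \<open>B\<^sup>\<dagger> y = \<Sum>\<^sub>i \<langle>y, d\<^sub>i\<rangle> e\<^sub>i\<close>
  (lemma \<open>pseudoinverse_restriction\<close>), because \<open>B\<^sup>\<dagger> B\<close> is the projection onto the coordinates in
  \<open>I\<close> and \<open>B B\<^sup>\<dagger>\<close> the orthogonal projection onto \<open>V\<close>. The adjoint of this
  finite-rank operator applied to \<open>s\<close> is \<open>\<Sum>\<^sub>i s\<^sub>i d\<^sub>i\<close>.
\<close>

text \<open>One Gram--Schmidt step per generator: the part of the new generator orthogonal to the old
  span either vanishes, and the span does not grow, or adds one orthogonal direction.\<close>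

lemma orthogonal_projection_onto_finite_span:
  fixes S :: "'h::real_inner set"
  assumes "finite S"
  shows "\<exists>p\<in>span S. \<forall>y\<in>span S. inner (x - p) y = 0"
  using assms
proof (induction S arbitrary: x)
  case empty
  show ?case by simp
next
  case (insert a S)
  obtain p where p: "p \<in> span S" "\<And>y. y \<in> span S \<Longrightarrow> inner (a - p) y = 0"
    using insert.IH[of a] by blast
  obtain r where r: "r \<in> span S" "\<And>y. y \<in> span S \<Longrightarrow> inner (x - r) y = 0"
    using insert.IH[of x] by blast
  define q where "q = a - p"
  define t where "t = inner (x - r) q / inner q q"
  have sub: "span S \<subseteq> span (insert a S)" by (rule span_mono) blast
  have q_in: "q \<in> span (insert a S)"
    unfolding q_def using p(1) sub by (intro span_diff) (auto intro: span_base)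
  have "inner (x - (r + t *\<^sub>R q)) y = 0" if y: "y \<in> span (insert a S)" for y
  proof -
    obtain k where "y - k *\<^sub>R a \<in> span S"
      using y by (auto simp: span_breakdown_eq)
    then have "y - k *\<^sub>R a + k *\<^sub>R p \<in> span S"
      using p(1) by (intro span_add span_scale)
    then obtain z where z: "z \<in> span S" "y = z + k *\<^sub>R q"
      by (metis (no_types, lifting) q_def add.commute add_diff_eq diff_add_cancel diff_diff_eq2
          scaleR_right_diff_distrib)
    have "inner (x - r) q = t * inner q q" by (simp add: t_def)
    moreover have "inner (x - r) z = 0" "inner q z = 0" using r(2) p(2) z(1) by (auto simp: q_def)
    ultimately show ?thesis
      by (simp add: z(2) inner_diff_left inner_add_left inner_add_right algebra_simps)
  qed
  moreover have "r + t *\<^sub>R q \<in> span (insert a S)"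
    using r(1) sub q_in by (intro span_add span_scale) auto
  ultimately show ?case by blast
qed

text \<open>The dual vector of \<open>v i\<close> is the rescaled component of \<open>v i\<close> orthogonal to all the
  other vectors; linear independence makes this component nonzero.\<close>

lemma biorthogonal_family_exists:
  fixes v :: "'i \<Rightarrow> 'h::real_inner"
  assumes fin: "finite I"
    and indep: "\<And>i. i \<in> I \<Longrightarrow> v i \<notin> span (v ` (I - {i}))"
  obtains d where "\<And>i. i \<in> I \<Longrightarrow> d i \<in> span (v ` I)"
    and "\<And>i j. i \<in> I \<Longrightarrow> j \<in> I \<Longrightarrow> inner (v j) (d i) = (if i = j then 1 else 0)"
proof -
  have "\<exists>d. d \<in> span (v ` I) \<and> (\<forall>j\<in>I. inner (v j) d = (if i = j then 1 else 0))"
    if i: "i \<in> I" for i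
  proof -
    obtain p where p: "p \<in> span (v ` (I - {i}))"
        "\<And>y. y \<in> span (v ` (I - {i})) \<Longrightarrow> inner (v i - p) y = 0"
      using orthogonal_projection_onto_finite_span[of "v ` (I - {i})" "v i"] fin by blast
    define q where "q = v i - p"
    have q0: "inner q q \<noteq> 0" using p(1) indep[OF i] by (auto simp: q_def)
    have "p \<in> span (v ` I)" using p(1) span_mono[of "v ` (I - {i})" "v ` I"] by blast
    then have "q \<in> span (v ` I)"
      unfolding q_def using i by (intro span_diff) (auto intro: span_base)
    then have "q /\<^sub>R inner q q \<in> span (v ` I)" by (rule span_scale)
    moreover have "inner (v j) q = 0" if "j \<in> I" "j \<noteq> i" for j
      using p(2)[of "v j"] that by (auto simp: q_def inner_commute intro: span_base)
    moreover have "inner (v i) q = inner q q"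
    proof -
      have "inner q p = 0" using p by (simp add: q_def)
      moreover have "inner (v i) q = inner q q + inner q p"
        by (simp add: q_def inner_diff_left inner_diff_right inner_commute)
      ultimately show ?thesis by simp
    qed
    ultimately show ?thesis using q0 by (intro exI[of _ "q /\<^sub>R inner q q"]) auto
  qed
  then show ?thesis using that by metis
qed

lemma coord_span_basis_vec:
  assumes "x \<in> span (basis_vec ` J)" "i \<notin> J"
  shows "coord x i = 0"
  using assms(1)
  by (induction rule: span_induct_alt) (use assms(2) in \<open>auto simp: coord_basis_vec split: if_splits\<close>)

text \<open>Injectivity on the span of the basis vectors in \<open>I\<close> turns the independence of these basis
  vectors into that of their images.\<close>

lemma image_basis_vec_independent:
  fixes K :: "l2 \<Rightarrow> 'h::real_vector"
  assumes "linear K" "inj_on K (span (basis_vec ` I))" "i \<in> I"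
  shows "K (basis_vec i) \<notin> span ((\<lambda>j. K (basis_vec j)) ` (I - {i}))"
proof
  assume "K (basis_vec i) \<in> span ((\<lambda>j. K (basis_vec j)) ` (I - {i}))"
  also have "\<dots> = K ` span (basis_vec ` (I - {i}))"
    using linear_span_image[OF assms(1), of "basis_vec ` (I - {i})"] by (simp add: image_image)
  finally obtain x where x: "x \<in> span (basis_vec ` (I - {i}))" "K (basis_vec i) = K x" by blast
  have "x \<in> span (basis_vec ` I)"
    using x(1) span_mono[of "basis_vec ` (I - {i})" "basis_vec ` I"] by blast
  moreover have "basis_vec i \<in> span (basis_vec ` I)" using assms(3) by (auto intro: span_base)
  ultimately have "basis_vec i = x" using x(2) assms(2) by (auto dest: inj_onD)
  then show False
    using coord_span_basis_vec[OF x(1), of i] by (auto simp: coord_basis_vec dest: sym)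
qed

text \<open>Biorthogonality makes the displayed operator a left inverse of \<open>K\<close> on the coordinates in
  \<open>I\<close>. That the \<open>d i\<close> lie in the span of the images is what makes it the Moore--Penrose inverse
  among all left inverses: it then annihilates the orthogonal complement of that span.\<close>

lemma pseudoinverse_restriction:
  fixes K :: "l2 \<Rightarrow> 'h::real_inner"
  assumes lin: "linear K" and fin: "finite I"
    and d_in: "\<And>i. i \<in> I \<Longrightarrow> d i \<in> span ((\<lambda>j. K (basis_vec j)) ` I)"
    and bi: "\<And>i j. i \<in> I \<Longrightarrow> j \<in> I \<Longrightarrow> inner (K (basis_vec j)) (d i) = (if i = j then 1 else 0)"
  shows "pseudoinverse (K \<circ> proj I) = (\<lambda>y. \<Sum>i\<in>I. inner y (d i) *\<^sub>R basis_vec i)"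
proof (rule pseudoinverse_eqI)
  define X where "X = (\<lambda>y. \<Sum>i\<in>I. inner y (d i) *\<^sub>R basis_vec i)"
  let ?B = "K \<circ> proj I"
  let ?V = "span ((\<lambda>j. K (basis_vec j)) ` I)"
  have B: "?B x = (\<Sum>j\<in>I. coord x j *\<^sub>R K (basis_vec j))" for x
    using fin by (simp add: proj_finite linear_sum[OF lin] linear_scale[OF lin])
  have cX: "coord (X y) i = (if i \<in> I then inner y (d i) else 0)" for y i
    using fin by (simp add: X_def coord_sum coord_basis_vec if_distrib cong: if_cong)
  have XB: "X (?B x) = proj I x" for x
  proof (rule l2_eqI)
    fix i
    have "inner (?B x) (d i) = coord x i" if "i \<in> I"
      unfolding B using fin that by (simp add: inner_sum_left bi if_distrib cong: if_cong)
    then show "coord (X (?B x)) i = coord (proj I x) i" by (simp add: cX coord_proj)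
  qed
  have proj_idem: "proj I (proj I x) = proj I x" for x
    by (rule l2_eqI) (simp add: coord_proj)
  have BXB: "?B (X (?B x)) = ?B x" for x by (simp only: XB) (simp add: proj_idem)
  have B_in: "?B x \<in> ?V" for x
    unfolding B by (intro span_sum span_scale) (auto intro: span_base)
  have V_range: "\<exists>x. p = ?B x" if "p \<in> ?V" for p
  proof -
    have "p \<in> K ` span (basis_vec ` I)"
      using that linear_span_image[OF lin, of "basis_vec ` I"] by (simp add: image_image)
    then obtain x where x: "x \<in> span (basis_vec ` I)" "p = K x" by blast
    have "proj I x = x"
      by (rule l2_eqI) (auto simp: coord_proj coord_span_basis_vec[OF x(1)])
    then have "p = ?B x" using x(2) by simp
    then show ?thesis ..
  qed
  \<comment> \<open>The map taking \<open>y\<close> to \<open>?B (X y)\<close> is the orthogonal projection onto \<open>?V\<close>: \<open>X\<close> sees only the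
    projection of \<open>y\<close>, and \<open>?B\<close> recovers every vector of \<open>?V\<close> from its image under \<open>X\<close>.\<close>
  have BX_orth: "inner (y - ?B (X y)) z = 0" if z: "z \<in> ?V" for y z
  proof -
    obtain p where p: "p \<in> ?V" "\<And>z. z \<in> ?V \<Longrightarrow> inner (y - p) z = 0"
      using orthogonal_projection_onto_finite_span[of "(\<lambda>j. K (basis_vec j)) ` I" y] fin by blast
    have "inner y (d i) = inner p (d i)" if "i \<in> I" for i
      using p(2)[OF d_in[OF that]] by (simp add: inner_diff_left)
    then have "X y = X p" by (simp add: X_def)
    moreover have "?B (X p) = p" using V_range[OF p(1)] BXB by metis
    ultimately show ?thesis using p(2)[OF z] by simp
  qed
  have BX_inner: "inner (?B (X y)) z = inner (?B (X y)) (?B (X z))" for y z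
    using BX_orth[OF B_in, of z "X y"] by (metis inner_commute inner_diff_left eq_iff_diff_eq_0)
  have BX_sym: "inner (?B (X y)) z = inner y (?B (X z))" for y z
    using BX_inner[of y z] BX_inner[of z y] by (simp add: inner_commute)
  have XBX: "X (?B (X y)) = X y" for y
    unfolding XB by (rule l2_eqI) (simp add: coord_proj cX)
  have XB_sym: "inner (X (?B x)) z = inner x (X (?B z))" for x z
    unfolding XB proj_finite[OF fin]
    by (simp add: inner_sum_left inner_sum_right inner_basis_vec inner_commute[of x] mult.commute)
  have "bounded_linear X"
    unfolding X_def
    by (intro bounded_linear_sum bounded_linear_compose[OF bounded_linear_scaleR_left]
        bounded_linear_inner_left)
  then show "is_pseudoinverse ?B (\<lambda>y. \<Sum>i\<in>I. inner y (d i) *\<^sub>R basis_vec i)"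
    unfolding is_pseudoinverse_def X_def[symmetric] using BXB XBX BX_sym XB_sym by blast
qed

lemma l1_norm_finite_support:
  assumes "finite I" "\<And>i. i \<notin> I \<Longrightarrow> coord x i = 0"
  shows "l1_norm x = ennreal (\<Sum>i\<in>I. \<bar>coord x i\<bar>)"
proof -
  have "l1_norm x = (\<Sum>\<^sub>\<infinity>i\<in>I. ennreal \<bar>coord x i\<bar>)"
    unfolding l1_norm_def using assms(2) by (intro infsum_cong_neutral) auto
  then show ?thesis using assms(1) by (simp add: sum_ennreal)
qed

theorem proposition5p1:
  fixes K :: "l2 \<Rightarrow> 'h::{real_inner, complete_space}"
    and I :: "int set"
  assumes "separable_space (euclidean :: 'h topology)"
    and "bounded_linear K"
    and "finite I"
    and "inj_on K (span (basis_vec ` I))"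
    and "(SUP i\<in>-I. l1_norm (pseudoinverse (K \<circ> proj I) (K (basis_vec i)))) < 1"
  shows "\<forall>u. supp u \<subseteq> I \<longrightarrow>
           (\<exists>w. proj I (adjoint K w) = proj I (sign_l2 u)
              \<and> linf_norm (proj (-I) (adjoint K w)) < 1)"
proof (intro allI impI)
  fix u assume "supp u \<subseteq> I"
  then have finsupp: "finite (supp u)" using assms(3) finite_subset by blast
  have lin: "linear K" using assms(2) by (rule bounded_linear.linear)
  obtain d where d_in: "\<And>i. i \<in> I \<Longrightarrow> d i \<in> span ((\<lambda>j. K (basis_vec j)) ` I)"
    and bi: "\<And>i j. i \<in> I \<Longrightarrow> j \<in> I \<Longrightarrow> inner (K (basis_vec j)) (d i) = (if i = j then 1 else 0)"
    using biorthogonal_family_exists[OF assms(3), of "\<lambda>j. K (basis_vec j)"]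
      image_basis_vec_independent[OF lin assms(4)] by blast
  let ?X = "pseudoinverse (K \<circ> proj I)"
  have X: "?X = (\<lambda>y. \<Sum>i\<in>I. inner y (d i) *\<^sub>R basis_vec i)"
    by (rule pseudoinverse_restriction[OF lin assms(3) d_in bi])
  have cX: "coord (?X y) i = (if i \<in> I then inner y (d i) else 0)" for y i
    using assms(3) by (simp add: X coord_sum coord_basis_vec if_distrib cong: if_cong)
  have l1: "l1_norm (?X y) = ennreal (\<Sum>i\<in>I. \<bar>inner y (d i)\<bar>)" for y
    using l1_norm_finite_support[OF assms(3), of "?X y"] by (simp add: cX)
  define w where "w = (\<Sum>i\<in>I. sgn (coord u i) *\<^sub>R d i)"
  have c: "coord (adjoint K w) j = (\<Sum>i\<in>I. sgn (coord u i) * inner (K (basis_vec j)) (d i))" for j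
    by (simp add: inner_basis_vec[symmetric] adjoint_l2_works[OF assms(2), symmetric]
        w_def inner_sum_right)
  have "proj I (adjoint K w) = proj I (sign_l2 u)"
  proof (rule l2_eqI)
    fix j
    have "coord (adjoint K w) j = sgn (coord u j)" if "j \<in> I"
      unfolding c using assms(3) that by (simp add: bi if_distrib cong: if_cong)
    then show "coord (proj I (adjoint K w)) j = coord (proj I (sign_l2 u)) j"
      by (simp add: coord_proj coord_sign[OF finsupp])
  qed
  moreover have "linf_norm (proj (-I) (adjoint K w)) \<le> (SUP i\<in>-I. l1_norm (?X (K (basis_vec i))))"
    unfolding linf_norm_def
  proof (rule SUP_least)
    fix j
    show "ennreal \<bar>coord (proj (-I) (adjoint K w)) j\<bar> \<le> (SUP i\<in>-I. l1_norm (?X (K (basis_vec i))))"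
    proof (cases "j \<in> I")
      case True
      then show ?thesis by (simp add: coord_proj)
    next
      case False
      have "\<bar>coord (adjoint K w) j\<bar> \<le> (\<Sum>i\<in>I. \<bar>sgn (coord u i) * inner (K (basis_vec j)) (d i)\<bar>)"
        unfolding c by (rule sum_abs)
      also have "\<dots> \<le> (\<Sum>i\<in>I. \<bar>inner (K (basis_vec j)) (d i)\<bar>)"
        by (rule sum_mono) (auto simp: abs_mult sgn_if)
      finally have "ennreal \<bar>coord (adjoint K w) j\<bar> \<le> l1_norm (?X (K (basis_vec j)))"
        unfolding l1 by (rule ennreal_leI)
      also have "\<dots> \<le> (SUP i\<in>-I. l1_norm (?X (K (basis_vec i))))"
        using False by (intro SUP_upper) simp
      finally show ?thesis using False by (simp add: coord_proj)
    qed
  qed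
  ultimately show "\<exists>w. proj I (adjoint K w) = proj I (sign_l2 u)
      \<and> linf_norm (proj (-I) (adjoint K w)) < 1"
    using assms(5) by (auto intro: le_less_trans)
qed

end
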